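(* Let $x^*\in A\cap B$, and suppose the $rl$-angle condition and the $rl$-three-point inequality are satisfied at $x^*$. Then there exists a neighborhood $V$ of $x^*$ such that every Bregman alternating sequence between $A$ and $B$ which enters $V$ (i.e. one of whose iterates $a_k$ or $b_k$ belongs to $V$) converges to some point in the intersection: there is $b^\sharp\in A\cap B$ with $a_k\to b^\sharp$ and $b_k\to b^\sharp$.
   Context: Setting: $f:\mathbb R^d\to\mathbb R\cup\{+\infty\}$ is a convex function of Legendre type (in Rockafellar's sense), $G:=\mathrm{int}(\mathrm{dom} f)$, $f$ is of class $C^2$ on $G$ and $\nabla^2f(x)\succ0$ for all $x\in G$. The Bregman distance is $D(x,y)=f(x)-f(y)-\langle\nabla f(y),x-y\rangle$ for $y\in G$ and $D(x,y)=+\infty$ otherwise. $A,B\subset G$ are nonempty, closed and bounded. Projections: $\overleftarrow{D}_B(a)=\min\{D(b',a):b'\in B\}$, $\overleftarrow{P}_B(a)=\mathrm{argmin}\{D(b',a):b'\in B\}$; $\overrightarrow{P}_A(b)=\mathrm{argmin}\{D(b,a'):a'\in A\}$ (set-valued). A Bregman alternating sequence is $a_k\in A$, $b_k\in B$ with $b_k\in\overleftarrow{P}_B(a_k)$, $a_{k+1}\in\overrightarrow{P}_A(b_k)$ for all $k$. An $rl$-building block $b\to a^+\to b^+$ consists of $b\in B$, $a^+\in\overrightarrow{P}_A(b)$, $b^+\in\overleftarrow{P}_B(a^+)$. De-singularizing function: a continuous concave $\phi:[0,\eta)\to\mathbb R_+$ with $\phi(0)=0$, $\phi$ of class $C^1$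 on $(0,\eta)$, $\phi'>0$ on $(0,\eta)$. $rl$-angle condition at $x^*\in A\cap B$ (gap value $r^*=0$): there exist a neighborhood $W$ of $(x^*,x^* )$, constants $\gamma,\eta>0$ and a de-singularizing function $\phi:[0,\eta)\to\mathbb R_+$ such that $\sigma(s)=\phi'(s)^{-2}s^{-1}$ is nondecreasing and $$\frac{1-\cos\alpha}{\sigma(\overleftarrow{D}_B(a^+))}\ge\gamma$$ for every $rl$-building block $b\to a^+\to b^+$ with $(b^+,a^+)\in W$ and $0<D(b^+,a^+)<\eta$, where $\alpha$ is the angle between $b-a^+$ and $b^+-a^+$. $rl$-three-point inequality at $x^*$: there exist $\ell\in(0,1)$ and $\delta>0$ such that $D(b,a^+)\ge D(b^+,a^+)+\ell D(b,b^+)$ for every $rl$-building block $b\to a^+\to b^+$ with $\|b^+-x^*\|<\delta$, $\|a^+-x^*\|<\delta$. *)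

theory Defs
  imports "HOL-Analysis.Analysis"
begin

section \<open>Convex functions of Legendre type\<close>

definition effective_dom :: "('a \<Rightarrow> ereal) \<Rightarrow> 'a set" where
  "effective_dom f = {x. f x < \<infinity>}"

definition int_dom :: "('a::topological_space \<Rightarrow> ereal) \<Rightarrow> 'a set" where
  "int_dom f = interior (effective_dom f)"

definition ereal_convex :: "('a::real_vector \<Rightarrow> ereal) \<Rightarrow> bool" where
  "ereal_convex f \<longleftrightarrow>
     (\<forall>x. f x \<noteq> -\<infinity>) \<and> convex {(x, r::real). f x \<le> ereal r}"

definition strictly_convex_on :: "'a::real_vector set \<Rightarrow> ('a \<Rightarrow> real) \<Rightarrow> bool" where
  "strictly_convex_on S F \<longleftrightarrow> convex S \<and>
     (\<forall>x\<in>S. \<forall>y\<in>S. \<forall>t\<in>{0<..<1}. x \<noteq> y \<longrightarrow>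
        F ((1 - t) *\<^sub>R x + t *\<^sub>R y) < (1 - t) * F x + t * F y)"

text \<open>The junk value \<open>0\<close> of \<^const>\<open>real_of_ereal\<close> at \<open>\<infinity>\<close> is harmless: all derivatives below are taken
  at points of the open set \<^const>\<open>int_dom\<close>, where \<open>f\<close> is finite.\<close>

abbreviation rpart :: "('a \<Rightarrow> ereal) \<Rightarrow> 'a \<Rightarrow> real" where
  "rpart f \<equiv> (\<lambda>x. real_of_ereal (f x))"

definition grad :: "('a::real_inner \<Rightarrow> real) \<Rightarrow> 'a \<Rightarrow> 'a" where
  "grad F x = (THE v. GDERIV F x :> v)"

text \<open>Rockafellar, \<^emph>\<open>Convex Analysis\<close>, Section 26: with \<open>C = int (dom f)\<close>, the pair \<open>(C, f)\<close> is of
  Legendre type, i.e. \<open>C\<close> is a nonempty open convex set, \<open>f\<close> is strictly convex and differentiable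
  on \<open>C\<close>, and \<open>|\<nabla>f|\<close> blows up at the boundary of \<open>C\<close>. Values of \<open>f\<close> on the boundary of its
  domain play no role in this notion.\<close>

definition legendre_type :: "('a::euclidean_space \<Rightarrow> ereal) \<Rightarrow> bool" where
  "legendre_type f \<longleftrightarrow>
     ereal_convex f \<and>
     int_dom f \<noteq> {} \<and>
     strictly_convex_on (int_dom f) (rpart f) \<and>
     (\<forall>x\<in>int_dom f. rpart f differentiable (at x)) \<and>
     (\<forall>z x. (\<forall>i::nat. z i \<in> int_dom f) \<and> x \<in> frontier (int_dom f) \<and> z \<longlonglongrightarrow> x \<longrightarrow>
        filterlim (\<lambda>i. norm (grad (rpart f) (z i))) at_top sequentially)"

definition hessian :: "(real^'n \<Rightarrow> real) \<Rightarrow> real^'n \<Rightarrow> real^'n^'n" where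
  "hessian F x = jacobian (grad F) (at x)"

definition C2_on :: "(real^'n) set \<Rightarrow> (real^'n \<Rightarrow> real) \<Rightarrow> bool" where
  "C2_on S F \<longleftrightarrow>
     (\<forall>x\<in>S. F differentiable (at x)) \<and>
     (\<forall>x\<in>S. grad F differentiable (at x)) \<and>
     continuous_on S (hessian F)"

definition pos_def :: "real^'n^'n \<Rightarrow> bool" where
  "pos_def M \<longleftrightarrow> transpose M = M \<and> (\<forall>h. h \<noteq> 0 \<longrightarrow> h \<bullet> (M *v h) > 0)"


section \<open>Bregman distance, projections, alternating sequences\<close>

definition bregman :: "('a::euclidean_space \<Rightarrow> ereal) \<Rightarrow> 'a \<Rightarrow> 'a \<Rightarrow> ereal" where
  "bregman f x y =
     (if y \<in> int_dom f then f x - f y - ereal (grad (rpart f) y \<bullet> (x - y)) else \<infinity>)"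

text \<open>The infimum is a minimum in the situation considered, \<open>B\<close> being a nonempty compact subset of
  \<open>int (dom f)\<close>.\<close>

definition left_dist :: "('a::euclidean_space \<Rightarrow> ereal) \<Rightarrow> 'a set \<Rightarrow> 'a \<Rightarrow> ereal" where
  "left_dist f B a = (INF b'\<in>B. bregman f b' a)"

definition left_proj :: "('a::euclidean_space \<Rightarrow> ereal) \<Rightarrow> 'a set \<Rightarrow> 'a \<Rightarrow> 'a set" where
  "left_proj f B a = {b. is_arg_min (\<lambda>b'. bregman f b' a) (\<lambda>b'. b' \<in> B) b}"

definition right_proj :: "('a::euclidean_space \<Rightarrow> ereal) \<Rightarrow> 'a set \<Rightarrow> 'a \<Rightarrow> 'a set" where
  "right_proj f A b = {a. is_arg_min (\<lambda>a'. bregman f b a') (\<lambda>a'. a' \<in> A) a}"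

definition bregman_alternating ::
  "('a::euclidean_space \<Rightarrow> ereal) \<Rightarrow> 'a set \<Rightarrow> 'a set \<Rightarrow> (nat \<Rightarrow> 'a) \<Rightarrow> (nat \<Rightarrow> 'a) \<Rightarrow> bool" where
  "bregman_alternating f A B a b \<longleftrightarrow>
     (\<forall>k. a k \<in> A \<and> b k \<in> B \<and> b k \<in> left_proj f B (a k) \<and> a (Suc k) \<in> right_proj f A (b k))"

definition rl_block ::
  "('a::euclidean_space \<Rightarrow> ereal) \<Rightarrow> 'a set \<Rightarrow> 'a set \<Rightarrow> 'a \<Rightarrow> 'a \<Rightarrow> 'a \<Rightarrow> bool" where
  "rl_block f A B b a\<^sub>p b\<^sub>p \<longleftrightarrow> b \<in> B \<and> a\<^sub>p \<in> right_proj f A b \<and> b\<^sub>p \<in> left_proj f B a\<^sub>p"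


section \<open>Angle condition and three-point inequality\<close>

definition vec_angle :: "'a::real_inner \<Rightarrow> 'a \<Rightarrow> real" where
  "vec_angle u v = arccos (u \<bullet> v / (norm u * norm v))"

definition desingularizing :: "real \<Rightarrow> (real \<Rightarrow> real) \<Rightarrow> bool" where
  "desingularizing \<eta> \<phi> \<longleftrightarrow>
     continuous_on {0..<\<eta>} \<phi> \<and> concave_on {0..<\<eta>} \<phi> \<and>
     (\<forall>s\<in>{0..<\<eta>}. \<phi> s \<ge> 0) \<and> \<phi> 0 = 0 \<and>
     \<phi> C1_differentiable_on {0<..<\<eta>} \<and> (\<forall>s\<in>{0<..<\<eta>}. deriv \<phi> s > 0)"

definition sigma_of :: "(real \<Rightarrow> real) \<Rightarrow> real \<Rightarrow> real" where
  "sigma_of \<phi> s = deriv \<phi> s powi (-2) * s powi (-1)"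

text \<open>Only gap value \<open>0\<close>. The condition \<open>0 < D(b\<^sup>+, a\<^sup>+)\<close> guarantees that both vectors spanning
  the angle are nonzero.\<close>

definition rl_angle_condition ::
  "('a::euclidean_space \<Rightarrow> ereal) \<Rightarrow> 'a set \<Rightarrow> 'a set \<Rightarrow> 'a \<Rightarrow> bool" where
  "rl_angle_condition f A B x \<longleftrightarrow>
     (\<exists>W \<gamma> \<eta> \<phi>. open W \<and> (x, x) \<in> W \<and> \<gamma> > 0 \<and> \<eta> > 0 \<and>
        desingularizing \<eta> \<phi> \<and> mono_on {0<..<\<eta>} (sigma_of \<phi>) \<and>
        (\<forall>b a\<^sub>p b\<^sub>p. rl_block f A B b a\<^sub>p b\<^sub>p \<and> (b\<^sub>p, a\<^sub>p) \<in> W \<and>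
            0 < bregman f b\<^sub>p a\<^sub>p \<and> bregman f b\<^sub>p a\<^sub>p < ereal \<eta> \<longrightarrow>
            (1 - cos (vec_angle (b - a\<^sub>p) (b\<^sub>p - a\<^sub>p)))
              / sigma_of \<phi> (real_of_ereal (left_dist f B a\<^sub>p)) \<ge> \<gamma>))"

definition rl_three_point ::
  "('a::euclidean_space \<Rightarrow> ereal) \<Rightarrow> 'a set \<Rightarrow> 'a set \<Rightarrow> 'a \<Rightarrow> bool" where
  "rl_three_point f A B x \<longleftrightarrow>
     (\<exists>l\<in>{0<..<1}. \<exists>\<delta>>0. \<forall>b a\<^sub>p b\<^sub>p.
        rl_block f A B b a\<^sub>p b\<^sub>p \<and> norm (b\<^sub>p - x) < \<delta> \<and> norm (a\<^sub>p - x) < \<delta> \<longrightarrow>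
        bregman f b a\<^sub>p \<ge> bregman f b\<^sub>p a\<^sub>p + ereal l * bregman f b b\<^sub>p)"

end

theory Submission
  imports Defs
begin

text \<open>
  On the compact convex hull of \<open>A \<union> B\<close> a second order Taylor expansion makes \<open>D(u,v)\<close> comparable
  to \<open>|u - v|\<^sup>2\<close>. Put \<open>r\<^sub>k = D(b\<^sub>k,a\<^sub>k)\<close> and \<open>d\<^sub>k = |b\<^sub>k - b\<^sub>k\<^sub>+\<^sub>1|\<close>. By the law of cosines the angle
  condition yields \<open>\<kappa> \<le> \<phi>'(r\<^sub>k\<^sub>+\<^sub>1) d\<^sub>k\<close>, while the three-point inequality yields
  \<open>l c d\<^sub>k\<^sub>+\<^sub>1\<^sup>2 \<le> r\<^sub>k\<^sub>+\<^sub>1 - r\<^sub>k\<^sub>+\<^sub>2\<close>. Concavity of \<open>\<phi>\<close> combines the two into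
  \<open>d\<^sub>k\<^sub>+\<^sub>1\<^sup>2 \<le> d\<^sub>k K (\<phi>(r\<^sub>k\<^sub>+\<^sub>1) - \<phi>(r\<^sub>k\<^sub>+\<^sub>2))\<close>, so that
  \<open>2 d\<^sub>k\<^sub>+\<^sub>1 \<le> d\<^sub>k + K (\<phi>(r\<^sub>k\<^sub>+\<^sub>1) - \<phi>(r\<^sub>k\<^sub>+\<^sub>2))\<close>. Summing this, a sequence starting close to \<open>x\<close> has finite
  length and never leaves the region where the hypotheses apply. Finally
  \<open>\<kappa> r\<^sub>k\<^sub>+\<^sub>1 \<le> \<phi>(r\<^sub>1) d\<^sub>k\<close> forces \<open>a\<^sub>k\<close> and \<open>b\<^sub>k\<close> to the same limit.
\<close>

section \<open>Quadratic bounds for the Bregman distance\<close>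

text \<open>\<open>grad\<close> is a definite description, so existence and uniqueness must come
  first: the adjoint of the derivative, applied to 1, is the representing vector.\<close>

lemma GDERIV_grad:
  fixes F :: "'a::euclidean_space \<Rightarrow> real"
  assumes "F differentiable (at x)"
  shows "GDERIV F x :> grad F x"
proof -
  obtain F' where F': "(F has_derivative F') (at x)"
    using assms by (auto simp: differentiable_def)
  have "h \<bullet> adjoint F' 1 = F' h" for h
    using adjoint_works[OF has_derivative_linear[OF F'], of h 1] by simp
  then have ex: "GDERIV F x :> adjoint F' 1"
    using F' by (simp add: gderiv_def)
  have "v = adjoint F' 1" if "GDERIV F x :> v" for v
  proof -
    have "(\<lambda>h. h \<bullet> v) = (\<lambda>h. h \<bullet> adjoint F' 1)"
      using that ex unfolding gderiv_def by (rule has_derivative_unique)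
    then show ?thesis
      by (metis vector_eq_ldot)
  qed
  then have "\<exists>!v. GDERIV F x :> v" using ex by blast
  then show ?thesis unfolding grad_def by (rule theI')
qed

text \<open>One-dimensional Taylor expansion with Lagrange remainder of the restriction of
  \<open>F\<close> to the segment from \<open>v\<close> to \<open>u\<close>.\<close>

lemma Taylor_grad_hessian:
  fixes F :: "real^'n \<Rightarrow> real"
  assumes F: "\<And>z. z \<in> closed_segment v u \<Longrightarrow> F differentiable (at z)"
    and dF: "\<And>z. z \<in> closed_segment v u \<Longrightarrow> grad F differentiable (at z)"
  shows "\<exists>z\<in>closed_segment v u.
    F u - F v - grad F v \<bullet> (u - v) = (u - v) \<bullet> (hessian F z *v (u - v)) / 2"
proof -
  define p where "p = (\<lambda>t::real. v + t *\<^sub>R (u - v))"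
  have p_seg: "p t \<in> closed_segment v u" if "0 \<le> t" "t \<le> 1" for t
    using that by (force simp: p_def in_segment algebra_simps)
  have p': "(p has_derivative (\<lambda>h. h *\<^sub>R (u - v))) (at t)" for t
    unfolding p_def by (auto intro!: derivative_eq_intros)
  \<comment> \<open>The family of derivatives in the format of \<open>Taylor_up\<close>; at order 2
    only the indices 0, 1 and 2 are evaluated.\<close>
  define diff where "diff = (\<lambda>m::nat. if m = 0 then (\<lambda>t. F (p t))
    else if m = 1 then (\<lambda>t. grad F (p t) \<bullet> (u - v))
    else (\<lambda>t. (hessian F (p t) *v (u - v)) \<bullet> (u - v)))"
  have D0: "DERIV (\<lambda>t. F (p t)) t :> grad F (p t) \<bullet> (u - v)" if "0 \<le> t" "t \<le> 1" for t
  proof -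
    have "(F has_derivative (\<lambda>h. h \<bullet> grad F (p t))) (at (p t))"
      using GDERIV_grad[OF F[OF p_seg[OF that]]] by (simp add: gderiv_def)
    from has_derivative_compose[OF p' this] show ?thesis
      by (simp add: has_field_derivative_def inner_commute mult_commute_abs)
  qed
  have D1: "DERIV (\<lambda>t. grad F (p t) \<bullet> (u - v)) t :> (hessian F (p t) *v (u - v)) \<bullet> (u - v)"
    if "0 \<le> t" "t \<le> 1" for t
  proof -
    have "(grad F has_derivative (\<lambda>h. hessian F (p t) *v h)) (at (p t))"
      using dF[OF p_seg[OF that]] unfolding hessian_def jacobian_works .
    from has_derivative_inner_left[OF has_derivative_compose[OF p' this], of "u - v"] show ?thesis
      by (simp add: has_field_derivative_def matrix_vector_mult_scaleR mult_commute_abs)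
  qed
  have "\<exists>t::real. 0 < t \<and> t < 1 \<and>
    (\<lambda>t. F (p t)) 1 = (\<Sum>m<2. (diff m 0 / fact m) * (1 - 0)^m) + (diff 2 t / fact 2) * (1 - 0)^2"
  proof (rule Taylor_up)
    show "\<forall>m t. m < 2 \<and> 0 \<le> t \<and> t \<le> 1 \<longrightarrow> DERIV (diff m) t :> diff (Suc m) t"
    proof (intro allI impI)
      fix m :: nat and t :: real assume "m < 2 \<and> 0 \<le> t \<and> t \<le> 1"
      then show "DERIV (diff m) t :> diff (Suc m) t"
        using D0[of t] D1[of t] by (cases "m = 0") (auto simp: diff_def)
    qed
  qed (auto simp: diff_def)
  then obtain t where "0 < t" "t < 1"
    "F (p 1) = F (p 0) + grad F (p 0) \<bullet> (u - v) + (hessian F (p t) *v (u - v)) \<bullet> (u - v) / 2"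
    by (auto simp: diff_def numeral_2_eq_2)
  then show ?thesis
    by (intro bexI[of _ "p t"] p_seg) (auto simp: p_def inner_commute)
qed

text \<open>The form is continuous and positive on the product of \<open>K\<close> with the unit
  sphere, a compact set, so its extrema there are positive; homogeneity of degree 2 carries them to
  all \<open>h\<close>.\<close>

lemma quadratic_form_bounds:
  fixes H :: "'a::topological_space \<Rightarrow> real^'n^'n"
  assumes "compact K" "continuous_on K H"
    and pos: "\<And>y h. y \<in> K \<Longrightarrow> h \<noteq> 0 \<Longrightarrow> h \<bullet> (H y *v h) > 0"
  shows "\<exists>m>0. \<exists>M>0. \<forall>y\<in>K. \<forall>h. m * (norm h)\<^sup>2 \<le> h \<bullet> (H y *v h) \<and> h \<bullet> (H y *v h) \<le> M * (norm h)\<^sup>2"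
proof (cases "K = {}")
  case True
  then show ?thesis by (auto intro: exI[of _ 1])
next
  case False
  define S where "S = K \<times> sphere (0::real^'n) 1"
  define q where "q = (\<lambda>z. snd z \<bullet> (H (fst z) *v snd z))"
  have "continuous_on S (\<lambda>z. H (fst z))"
    by (rule continuous_on_compose2[OF assms(2)]) (auto simp: S_def intro!: continuous_intros)
  then have cont: "continuous_on S q"
    unfolding q_def inner_vec_def matrix_vector_mult_def
    by (auto intro!: continuous_intros)
  have S: "compact S" "S \<noteq> {}"
    using assms(1) False by (auto simp: S_def intro!: compact_Times)
  obtain z1 where z1: "z1 \<in> S" "\<And>z. z \<in> S \<Longrightarrow> q z1 \<le> q z"
    using continuous_attains_inf[OF S cont] by blast
  obtain z2 where z2: "z2 \<in> S" "\<And>z. z \<in> S \<Longrightarrow> q z \<le> q z2"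
    using continuous_attains_sup[OF S cont] by blast
  have qpos: "q z > 0" if "z \<in> S" for z
    using pos[of "fst z" "snd z"] that by (force simp: q_def S_def)
  have "q z1 * (norm h)\<^sup>2 \<le> h \<bullet> (H y *v h) \<and> h \<bullet> (H y *v h) \<le> q z2 * (norm h)\<^sup>2"
    if y: "y \<in> K" for y h
  proof (cases "h = 0")
    case False
    define e where "e = h /\<^sub>R norm h"
    have "(y, e) \<in> S" using y False by (simp add: S_def e_def)
    moreover have "h \<bullet> (H y *v h) = q (y, e) * (norm h)\<^sup>2"
      using False by (simp add: q_def e_def matrix_vector_mult_scaleR power2_eq_square field_simps)
    ultimately show ?thesis
      using z1 z2 by (simp add: mult_right_mono)
  qed simp
  then show ?thesis using qpos z1(1) z2(1) by blast
qed

lemma finite_on_int_dom: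
  assumes "ereal_convex f" "y \<in> int_dom f"
  shows "f y = ereal (rpart f y)"
proof -
  have "y \<in> effective_dom f" using assms(2) interior_subset unfolding int_dom_def by blast
  then show ?thesis
    using assms(1) by (cases "f y") (auto simp: effective_dom_def ereal_convex_def)
qed

text \<open>The Taylor remainder is evaluated on the segment between \<open>u\<close> and
  \<open>v\<close>, which convexity keeps inside \<open>K\<close>, where the Hessian has uniform
  bounds.\<close>

lemma bregman_quadratic_bounds:
  fixes f :: "real^'n \<Rightarrow> ereal"
  assumes conv: "ereal_convex f" and C2: "C2_on (int_dom f) (rpart f)"
    and pd: "\<And>y. y \<in> int_dom f \<Longrightarrow> pos_def (hessian (rpart f) y)"
    and K: "compact K" "convex K" "K \<subseteq> int_dom f"
  shows "\<exists>c>0. \<exists>C>0. \<forall>u\<in>K. \<forall>v\<in>K.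
    ereal (c * (norm (u - v))\<^sup>2) \<le> bregman f u v \<and> bregman f u v \<le> ereal (C * (norm (u - v))\<^sup>2)"
proof -
  have "continuous_on K (hessian (rpart f))"
    using C2 K(3) continuous_on_subset unfolding C2_on_def by blast
  from quadratic_form_bounds[OF K(1) this] obtain m M where mM: "m > 0" "M > 0"
    "\<And>y h. y \<in> K \<Longrightarrow> m * (norm h)\<^sup>2 \<le> h \<bullet> (hessian (rpart f) y *v h)"
    "\<And>y h. y \<in> K \<Longrightarrow> h \<bullet> (hessian (rpart f) y *v h) \<le> M * (norm h)\<^sup>2"
    using pd K(3) unfolding pos_def_def by blast
  have "ereal (m / 2 * (norm (u - v))\<^sup>2) \<le> bregman f u v \<and>
    bregman f u v \<le> ereal (M / 2 * (norm (u - v))\<^sup>2)" if uv: "u \<in> K" "v \<in> K" for u v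
  proof -
    have seg: "closed_segment v u \<subseteq> K" using uv K(2) by (simp add: closed_segment_subset)
    have "\<exists>z\<in>closed_segment v u. rpart f u - rpart f v - grad (rpart f) v \<bullet> (u - v)
      = (u - v) \<bullet> (hessian (rpart f) z *v (u - v)) / 2"
      using C2 seg K(3) by (intro Taylor_grad_hessian) (auto simp: C2_on_def)
    then obtain z where z: "z \<in> K" "rpart f u - rpart f v - grad (rpart f) v \<bullet> (u - v)
      = (u - v) \<bullet> (hessian (rpart f) z *v (u - v)) / 2"
      using seg by blast
    have "bregman f u v = ereal (rpart f u - rpart f v - grad (rpart f) v \<bullet> (u - v))"
    proof -
      have G: "u \<in> int_dom f" "v \<in> int_dom f" using uv K(3) by auto
      obtain r s where "f u = ereal r" "f v = ereal s"
        using finite_on_int_dom[OF conv G(1)] finite_on_int_dom[OF conv G(2)] by blast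
      then show ?thesis using G by (simp add: bregman_def)
    qed
    then show ?thesis
      using mM(3,4)[OF z(1), of "u - v"] z(2) by simp
  qed
  then show ?thesis
    using mM(1,2) by (intro exI[of _ "m / 2"] conjI exI[of _ "M / 2"]) auto
qed

section \<open>Angles and de-singularizing functions\<close>

text \<open>Zero vectors are covered too: division by zero yields 0, and \<open>arccos 0\<close> has
  cosine 0.\<close>

lemma cos_vec_angle: "cos (vec_angle u v) = u \<bullet> v / (norm u * norm v)"
proof -
  have "\<bar>u \<bullet> v / (norm u * norm v)\<bar> \<le> 1"
    using Cauchy_Schwarz_ineq2[of u v] by (cases "u = 0 \<or> v = 0") (auto simp: divide_le_eq_1)
  then show ?thesis by (simp add: vec_angle_def cos_arccos_abs)
qed

text \<open>The right-hand side exceeds the left by the square of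
  \<open>norm u - norm v\<close>.\<close>

lemma law_of_cosines_lower:
  "2 * (norm u * norm v) * (1 - cos (vec_angle u v)) \<le> (norm (u - v))\<^sup>2"
proof -
  have "norm u * norm v * cos (vec_angle u v) = u \<bullet> v"
    by (auto simp: cos_vec_angle)
  moreover have "(norm (u - v))\<^sup>2 = (norm u)\<^sup>2 + (norm v)\<^sup>2 - 2 * (u \<bullet> v)"
    by (simp add: power2_norm_eq_inner inner_diff inner_commute)
  moreover have "0 \<le> (norm u - norm v)\<^sup>2" by simp
  ultimately show ?thesis by (simp add: power2_diff algebra_simps)
qed

text \<open>A concave function lies below its tangents. The point of tangency \<open>s\<close> is
  interior, where \<phi> is differentiable, while \<open>r = 0\<close> stays allowed.\<close>

lemma desingularizing_tangent:
  assumes "desingularizing \<eta> \<phi>" "0 < s" "s < \<eta>" "0 \<le> r" "r < \<eta>"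
  shows "deriv \<phi> s * (s - r) \<le> \<phi> s - \<phi> r"
proof -
  have "\<phi> differentiable (at s)"
    using assms by (auto simp: desingularizing_def C1_differentiable_on_eq)
  then have "(\<phi> has_field_derivative deriv \<phi> s) (at s)"
    by (simp add: DERIV_deriv_iff_real_differentiable)
  then have d: "((\<lambda>x. - \<phi> x) has_field_derivative - deriv \<phi> s) (at s within {0..<\<eta>})"
    by (rule DERIV_minus[OF has_field_derivative_at_within])
  have "- deriv \<phi> s * (r - s) \<le> - \<phi> r - - \<phi> s"
    by (rule convex_on_imp_above_tangent[OF _ _ _ _ d])
      (use assms in \<open>auto simp: desingularizing_def concave_on_def\<close>)
  then show ?thesis by (simp add: algebra_simps)
qed

lemma desingularizing_mono:
  assumes "desingularizing \<eta> \<phi>" "0 \<le> r" "r \<le> s" "s < \<eta>"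
  shows "\<phi> r \<le> \<phi> s"
proof (cases "s = 0")
  case False
  then have "0 \<le> deriv \<phi> s * (s - r)"
    using assms False by (intro mult_nonneg_nonneg) (auto simp: desingularizing_def less_imp_le)
  also have "\<dots> \<le> \<phi> s - \<phi> r"
    using assms False by (intro desingularizing_tangent) auto
  finally show ?thesis by simp
qed (use assms in auto)

section \<open>Trapping of sequences of finite length\<close>

text \<open>Telescoping: with \<open>d n + p n\<close> added on the left the induction closes, since
  the hypothesis lets this surplus pay for the next term.\<close>

lemma sum_le_of_contractive:
  fixes d p :: "nat \<Rightarrow> real"
  assumes "\<And>k. k < n \<Longrightarrow> 2 * d (Suc k) \<le> d k + p k - p (Suc k)"
    and "p n \<ge> 0" "d n \<ge> 0"
  shows "(\<Sum>k\<le>n. d k) \<le> 2 * d 0 + p 0"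
proof -
  have "(\<Sum>k\<le>n. d k) + d n + p n \<le> 2 * d 0 + p 0"
    using assms(1) by (induction n) (force simp: less_Suc_eq)+
  then show ?thesis using assms by simp
qed

text \<open>\<open>step\<close> is available only near \<open>x\<close>, so nearness is proved by
  strong induction: as long as the iterates are near, the path length is at most
  \<open>2 * d 0 + p 0\<close>, and \<open>start\<close> keeps the next iterate near. Finite length
  and completeness give convergence.\<close>

lemma trapped_sequence_converges:
  fixes b :: "nat \<Rightarrow> 'a::banach"
  assumes step: "\<And>k. \<lbrakk>norm (b k - x) < \<epsilon>; norm (b (Suc k) - x) < \<epsilon>\<rbrakk> \<Longrightarrow>
      2 * norm (b (Suc k) - b (Suc (Suc k))) \<le> norm (b k - b (Suc k)) + p k - p (Suc k)"
    and p: "\<And>k. p k \<ge> 0"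
    and start: "norm (b 0 - x) + 2 * norm (b 0 - b 1) + p 0 < \<epsilon>"
  shows "norm (b n - x) < \<epsilon>" and "convergent b"
proof -
  define d where "d = (\<lambda>k. norm (b k - b (Suc k)))"
  have dist0: "norm (b n - x) \<le> norm (b 0 - x) + (\<Sum>k<n. d k)" for n
  proof (induction n)
    case (Suc n)
    have "norm (b (Suc n) - x) \<le> norm (b n - x) + d n"
      unfolding d_def using norm_triangle_sub[of "b (Suc n) - x" "b n - x"]
      by (simp add: norm_minus_commute)
    with Suc show ?case by simp
  qed simp
  have dstep: "2 * d (Suc k) \<le> d k + p k - p (Suc k)"
    if "norm (b k - x) < \<epsilon>" "norm (b (Suc k) - x) < \<epsilon>" for k
    using step[OF that] by (simp add: d_def)
  \<comment> \<open>Nearness up to \<open>b n\<close> already controls \<open>d n\<close>, hence the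
    jump to \<open>b (Suc n)\<close>; this extra index drives the induction.\<close>
  have bound: "(\<Sum>k\<le>n. d k) \<le> 2 * d 0 + p 0"
    if "\<And>k. k \<le> n \<Longrightarrow> norm (b k - x) < \<epsilon>" for n
    by (rule sum_le_of_contractive[of n d p]) (use that dstep p in \<open>auto simp: d_def\<close>)
  have near: "norm (b n - x) < \<epsilon>" for n
  proof (induction n rule: less_induct)
    case (less n)
    show ?case
    proof (cases n)
      case 0
      have "norm (b 0 - x) \<le> norm (b 0 - x) + 2 * norm (b 0 - b 1) + p 0" using p[of 0] by simp
      then show ?thesis using start 0 by simp
    next
      case (Suc m)
      have "(\<Sum>k\<le>m. d k) \<le> 2 * d 0 + p 0" using less Suc by (intro bound) auto
      then show ?thesis
        using dist0[of n] start Suc by (simp add: d_def lessThan_Suc_atMost)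
    qed
  qed
  then show "norm (b n - x) < \<epsilon>" .
  have "summable (\<lambda>k. norm (b (Suc k) - b k))"
    unfolding norm_minus_commute[of "b (Suc _)"] d_def[symmetric]
    by (rule bounded_imp_summable[OF _ bound[OF near]]) (simp add: d_def)
  then have "summable (\<lambda>k. b (Suc k) - b k)"
    by (rule summable_norm_cancel)
  then have "convergent (\<lambda>n. (\<Sum>k<n. b (Suc k) - b k) + b 0)"
    by (simp add: summable_iff_convergent convergent_add_const_right_iff)
  then show "convergent b" by (simp add: sum_lessThan_telescope)
qed

section \<open>Convergence under quadratic bounds\<close>

locale quadratic_bregman =
  fixes f :: "'a::euclidean_space \<Rightarrow> ereal" and A B :: "'a set" and c C :: real
  assumes c_pos: "c > 0" and C_pos: "C > 0"
    and lower: "\<lbrakk>u \<in> A \<union> B; v \<in> A \<union> B\<rbrakk> \<Longrightarrow> ereal (c * (norm (u - v))\<^sup>2) \<le> bregman f u v"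
    and upper: "\<lbrakk>u \<in> A \<union> B; v \<in> A \<union> B\<rbrakk> \<Longrightarrow> bregman f u v \<le> ereal (C * (norm (u - v))\<^sup>2)"
begin

text \<open>A real-valued copy, faithful on \<open>A \<union> B\<close>, where the two quadratic
  bounds force finiteness.\<close>

definition D :: "'a \<Rightarrow> 'a \<Rightarrow> real" where
  "D u v = real_of_ereal (bregman f u v)"

text \<open>The loss incurred when an inequality between Bregman distances is converted into one
  between norms, see \<open>norm_le_of_D_le\<close>.\<close>

definition Q :: real where
  "Q = sqrt (C / c)"

lemma Q_pos: "Q > 0"
  using c_pos C_pos by (simp add: Q_def)

lemma bregman_eq_D:
  assumes "u \<in> A \<union> B" "v \<in> A \<union> B"
  shows "bregman f u v = ereal (D u v)"
  using lower[OF assms] upper[OF assms] by (cases "bregman f u v") (auto simp: D_def)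

lemma D_lower: "\<lbrakk>u \<in> A \<union> B; v \<in> A \<union> B\<rbrakk> \<Longrightarrow> c * (norm (u - v))\<^sup>2 \<le> D u v"
  using lower[of u v] by (simp add: bregman_eq_D)

lemma D_upper: "\<lbrakk>u \<in> A \<union> B; v \<in> A \<union> B\<rbrakk> \<Longrightarrow> D u v \<le> C * (norm (u - v))\<^sup>2"
  using upper[of u v] by (simp add: bregman_eq_D)

lemma D_nonneg: "\<lbrakk>u \<in> A \<union> B; v \<in> A \<union> B\<rbrakk> \<Longrightarrow> 0 \<le> D u v"
  using D_lower[of u v] c_pos by (meson mult_nonneg_nonneg order_trans less_imp_le zero_le_power2)

section \<open>Projections and their distance to a common point\<close>

lemma right_proj_D:
  assumes "p \<in> right_proj f A b" "b \<in> A \<union> B"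
  shows "p \<in> A" and "a' \<in> A \<Longrightarrow> D b p \<le> D b a'"
proof -
  show p: "p \<in> A" using assms by (simp add: right_proj_def is_arg_min_def)
  show "D b p \<le> D b a'" if "a' \<in> A"
  proof -
    have "bregman f b p \<le> bregman f b a'"
      using assms(1) that by (auto simp: right_proj_def is_arg_min_def not_less)
    then show ?thesis using p that assms(2) by (simp add: bregman_eq_D)
  qed
qed

lemma left_proj_D:
  assumes "b \<in> left_proj f B p" "p \<in> A \<union> B"
  shows "b \<in> B" and "b' \<in> B \<Longrightarrow> D b p \<le> D b' p" and "left_dist f B p = ereal (D b p)"
proof -
  show b: "b \<in> B" using assms by (simp add: left_proj_def is_arg_min_def)
  have le: "bregman f b p \<le> bregman f b' p" if "b' \<in> B" for b'
    using assms(1) that by (auto simp: left_proj_def is_arg_min_def not_less)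
  then show "D b p \<le> D b' p" if "b' \<in> B"
    using b that assms(2) by (fastforce simp: bregman_eq_D)
  have "left_dist f B p = bregman f b p"
    unfolding left_dist_def by (rule antisym) (use b le in \<open>auto intro: INF_lower INF_greatest\<close>)
  then show "left_dist f B p = ereal (D b p)"
    using b assms(2) by (simp add: bregman_eq_D)
qed

lemma norm_le_of_D_le:
  assumes "u \<in> A \<union> B" "v \<in> A \<union> B" "u' \<in> A \<union> B" "v' \<in> A \<union> B" "D u v \<le> D u' v'"
  shows "norm (u - v) \<le> Q * norm (u' - v')"
proof (rule power2_le_imp_le)
  have "c * (norm (u - v))\<^sup>2 \<le> C * (norm (u' - v'))\<^sup>2"
    using D_lower[of u v] D_upper[of u' v'] assms by linarith
  then show "(norm (u - v))\<^sup>2 \<le> (Q * norm (u' - v'))\<^sup>2"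
    using c_pos C_pos by (simp add: Q_def power_mult_distrib field_simps)
qed (use Q_pos in auto)

text \<open>The common point \<open>x\<close> competes in the projection, so \<open>p\<close> is at
  most \<open>Q\<close> times as far from \<open>b\<close> as \<open>x\<close> is; the triangle
  inequality does the rest. \<open>left_proj_near\<close> is the mirror image.\<close>

lemma right_proj_near:
  assumes "x \<in> A" "b \<in> B" "p \<in> right_proj f A b"
  shows "norm (p - x) \<le> (1 + Q) * norm (b - x)"
proof -
  have "norm (b - p) \<le> Q * norm (b - x)"
    using right_proj_D[OF assms(3)] assms by (intro norm_le_of_D_le) auto
  moreover have "norm (p - x) \<le> norm (b - p) + norm (b - x)"
    using norm_triangle_sub[of "p - x" "b - x"] by (simp add: norm_minus_commute)
  ultimately show ?thesis by (simp add: algebra_simps)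
qed

lemma left_proj_near:
  assumes "x \<in> B" "p \<in> A" "b \<in> left_proj f B p"
  shows "norm (b - x) \<le> (1 + Q) * norm (p - x)"
proof -
  have "norm (b - p) \<le> Q * norm (x - p)"
    using left_proj_D[OF assms(3)] assms by (intro norm_le_of_D_le) auto
  moreover have "norm (b - x) \<le> norm (b - p) + norm (p - x)"
    using norm_triangle_sub[of "b - x" "p - x"] by (simp add: norm_minus_commute)
  ultimately show ?thesis by (simp add: algebra_simps norm_minus_commute)
qed

text \<open>Dividing by \<open>sigma_of\<close> amounts to multiplying by \<phi>'(r)^2 r, with r the
  value \<open>D b' p\<close>. Since r is at most a multiple of the product of the two legs of the
  angle, the law of cosines replaces r times one minus the cosine by the squared third side.\<close>

lemma angle_step:
  assumes block: "rl_block f A B b p b'" and pos: "D b' p > 0" and der: "deriv \<phi> (D b' p) > 0"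
    and \<gamma>: "\<gamma> > 0"
    and angle: "(1 - cos (vec_angle (b - p) (b' - p)))
      / sigma_of \<phi> (real_of_ereal (left_dist f B p)) \<ge> \<gamma>"
  shows "sqrt (2 * \<gamma> / (Q * C)) \<le> deriv \<phi> (D b' p) * norm (b - b')"
proof -
  define r t \<alpha> where "r = D b' p" and "t = deriv \<phi> r" and "\<alpha> = vec_angle (b - p) (b' - p)"
  have rt: "r > 0" "t > 0" using pos der by (auto simp: r_def t_def)
  have b: "b \<in> B" and p: "p \<in> A" and b': "b' \<in> B" and le: "D b' p \<le> D b p"
    and dist: "left_dist f B p = ereal r"
    using block right_proj_D left_proj_D by (auto simp: rl_block_def r_def)
  have "sigma_of \<phi> r = 1 / (t\<^sup>2 * r)"
    by (simp add: sigma_of_def t_def power_int_minus field_simps)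
  with angle dist have cos: "\<gamma> \<le> (1 - cos \<alpha>) * (t\<^sup>2 * r)"
    by (simp add: \<alpha>_def)
  \<comment> \<open>Minimality of \<open>b'\<close> lets one factor \<open>norm (b' - p)\<close> be
    traded for \<open>norm (b - p)\<close>, producing the product of legs in the law of
    cosines.\<close>
  have "norm (b' - p) \<le> Q * norm (b - p)"
    using b p b' le by (intro norm_le_of_D_le) auto
  then have "norm (b' - p) * norm (b' - p) \<le> Q * norm (b - p) * norm (b' - p)"
    by (rule mult_right_mono) simp
  then have "C * (norm (b' - p))\<^sup>2 \<le> C * (Q * (norm (b - p) * norm (b' - p)))"
    using C_pos by (simp add: power2_eq_square mult.assoc)
  moreover have "r \<le> C * (norm (b' - p))\<^sup>2"
    using D_upper[of b' p] p b' by (simp add: r_def)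
  ultimately have "r \<le> C * (Q * (norm (b - p) * norm (b' - p)))" by linarith
  then have "r * (1 - cos \<alpha>) \<le> C * (Q * (norm (b - p) * norm (b' - p))) * (1 - cos \<alpha>)"
    by (rule mult_right_mono) simp
  also have "2 * \<dots> \<le> C * Q * (norm (b - b'))\<^sup>2"
    using mult_left_mono[OF law_of_cosines_lower[of "b - p" "b' - p"], of "C * Q"] C_pos Q_pos
    by (simp add: \<alpha>_def algebra_simps)
  finally have "2 * (r * (1 - cos \<alpha>)) \<le> C * Q * (norm (b - b'))\<^sup>2" by simp
  then have "t\<^sup>2 * (2 * (r * (1 - cos \<alpha>))) \<le> t\<^sup>2 * (C * Q * (norm (b - b'))\<^sup>2)"
    by (rule mult_left_mono) simp
  also have "t\<^sup>2 * (2 * (r * (1 - cos \<alpha>))) = 2 * ((1 - cos \<alpha>) * (t\<^sup>2 * r))"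
    by (simp only: mult_ac)
  also have "t\<^sup>2 * (C * Q * (norm (b - b'))\<^sup>2) = (C * Q) * (t * norm (b - b'))\<^sup>2"
    by (simp only: power_mult_distrib mult_ac)
  finally have "2 * \<gamma> \<le> (C * Q) * (t * norm (b - b'))\<^sup>2"
    using cos by linarith
  then have "2 * \<gamma> / (Q * C) \<le> (t * norm (b - b'))\<^sup>2"
    using C_pos Q_pos by (simp add: field_simps)
  then show ?thesis
    using rt by (intro real_le_lsqrt) (auto simp: t_def r_def)
qed

section \<open>Alternating sequences near a common point\<close>

lemma rl_block_of_alternating:
  assumes "bregman_alternating f A B a b"
  shows "rl_block f A B (b k) (a (Suc k)) (b (Suc k))"
  using assms by (auto simp: bregman_alternating_def rl_block_def)

theorem alternating_converges:
  assumes "closed A" "closed B" and x: "x \<in> A" "x \<in> B"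
    and angle: "rl_angle_condition f A B x" and three: "rl_three_point f A B x"
  shows "\<exists>V. open V \<and> x \<in> V \<and>
           (\<forall>a b. bregman_alternating f A B a b \<and> (\<exists>k. a k \<in> V \<or> b k \<in> V) \<longrightarrow>
              (\<exists>b\<^sub>s \<in> A \<inter> B. a \<longlonglongrightarrow> b\<^sub>s \<and> b \<longlonglongrightarrow> b\<^sub>s))"
proof -
  obtain l \<delta> where "l \<in> {0<..<1}" and \<delta>: "\<delta> > 0" and three':
    "\<forall>b p b'. rl_block f A B b p b' \<and> norm (b' - x) < \<delta> \<and> norm (p - x) < \<delta> \<longrightarrow>
      bregman f b p \<ge> bregman f b' p + ereal l * bregman f b b'"
    using three unfolding rl_three_point_def by (elim bexE exE conjE) (rule that)
  then have l: "0 < l" "l < 1" by simp_all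
  obtain W \<gamma> \<eta> \<phi> where W: "open W" "(x, x) \<in> W" and \<gamma>: "\<gamma> > 0" and \<eta>: "\<eta> > 0"
    and \<phi>: "desingularizing \<eta> \<phi>" and angle':
    "\<forall>b p b'. rl_block f A B b p b' \<and> (b', p) \<in> W \<and>
        0 < bregman f b' p \<and> bregman f b' p < ereal \<eta> \<longrightarrow>
      (1 - cos (vec_angle (b - p) (b' - p))) / sigma_of \<phi> (real_of_ereal (left_dist f B p)) \<ge> \<gamma>"
    using angle unfolding rl_angle_condition_def by (elim exE conjE) (rule that)
  have \<phi>': "deriv \<phi> s > 0" if "0 < s" "s < \<eta>" for s
    using \<phi> that by (simp add: desingularizing_def)
  have \<phi>_nonneg: "\<phi> s \<ge> 0" if "0 \<le> s" "s < \<eta>" for s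
    using \<phi> that by (simp add: desingularizing_def)
  have \<phi>0: "\<phi> 0 = 0" using \<phi> by (simp add: desingularizing_def)

  obtain S T where ST: "open S" "open T" "(x, x) \<in> S \<times> T" "S \<times> T \<subseteq> W"
    by (rule open_prod_elim[OF W])
  have "open (S \<inter> T)" "x \<in> S \<inter> T" using ST by auto
  then obtain \<epsilon>\<^sub>W where \<epsilon>\<^sub>W: "\<epsilon>\<^sub>W > 0" "ball x \<epsilon>\<^sub>W \<subseteq> S \<inter> T"
    by (meson open_contains_ball)
  \<comment> \<open>The three bounds secure, in order, the three-point inequality, membership in
    \<open>W\<close>, and \<open>D u v < \<eta>\<close> for two points within \<epsilon> of
    \<open>x\<close>.\<close>
  define \<epsilon> where "\<epsilon> = min (min \<delta> \<epsilon>\<^sub>W) (sqrt (\<eta> / C) / 2)"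
  have \<epsilon>: "\<epsilon> > 0" using \<delta> \<epsilon>\<^sub>W \<eta> C_pos by (simp add: \<epsilon>_def)
  have in_W: "(u, v) \<in> W" if "norm (u - x) < \<epsilon>" "norm (v - x) < \<epsilon>" for u v
  proof -
    have "u \<in> ball x \<epsilon>\<^sub>W" "v \<in> ball x \<epsilon>\<^sub>W"
      using that by (simp_all add: \<epsilon>_def dist_norm norm_minus_commute)
    then show ?thesis using \<epsilon>\<^sub>W(2) ST(4) by blast
  qed
  have small: "D u v < \<eta>"
    if "norm (u - x) < \<epsilon>" "norm (v - x) < \<epsilon>" "u \<in> A \<union> B" "v \<in> A \<union> B" for u v
  proof -
    have "norm (u - v) < 2 * \<epsilon>"
      using that(1,2) norm_triangle_ineq4[of "u - x" "v - x"] by simp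
    also have "\<dots> \<le> sqrt (\<eta> / C)" by (simp add: \<epsilon>_def)
    finally have "(norm (u - v))\<^sup>2 < (sqrt (\<eta> / C))\<^sup>2"
      by (intro power_strict_mono) auto
    then have "C * (norm (u - v))\<^sup>2 < \<eta>"
      using C_pos \<eta> by (simp add: field_simps)
    with D_upper[of u v] that show ?thesis by simp
  qed

  define \<kappa> where "\<kappa> = sqrt (2 * \<gamma> / (Q * C))"
  have \<kappa>: "\<kappa> > 0" using \<gamma> Q_pos C_pos by (simp add: \<kappa>_def)
  have angle_block: "\<kappa> \<le> deriv \<phi> (D b' p) * norm (b - b')"
    if block: "rl_block f A B b p b'" and near: "norm (b' - x) < \<epsilon>" "norm (p - x) < \<epsilon>"
      and pos: "0 < D b' p" for b p b'
  proof -
    have mem: "p \<in> A" "b' \<in> B"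
      using block right_proj_D left_proj_D by (auto simp: rl_block_def)
    then have "D b' p < \<eta>" using near by (intro small) auto
    then show ?thesis
      unfolding \<kappa>_def using mem pos
      by (intro angle_step[OF block pos \<phi>' \<gamma> angle'[rule_format]] conjI block in_W near)
        (auto simp: bregman_eq_D)
  qed
  have three_block: "D b' p + l * c * (norm (b - b'))\<^sup>2 \<le> D b p"
    if block: "rl_block f A B b p b'" and near: "norm (b' - x) < \<epsilon>" "norm (p - x) < \<epsilon>" for b p b'
  proof -
    have mem: "b \<in> B" "p \<in> A" "b' \<in> B"
      using block right_proj_D left_proj_D by (auto simp: rl_block_def)
    have "bregman f b' p + ereal l * bregman f b b' \<le> bregman f b p"
      using block near by (intro three'[rule_format] conjI) (auto simp: \<epsilon>_def)
    then have "D b' p + l * D b b' \<le> D b p" using mem by (simp add: bregman_eq_D)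
    moreover have "l * (c * (norm (b - b'))\<^sup>2) \<le> l * D b b'"
      using mem l D_lower[of b b'] by (intro mult_left_mono) auto
    ultimately show ?thesis by (simp add: mult.assoc)
  qed

  define K where "K = 1 / (\<kappa> * l * c)"
  have K: "K > 0" using \<kappa> l c_pos by (simp add: K_def)
  define q where "q = 1 + Q"
  have q: "q > 1" using Q_pos by (simp add: q_def)
  \<comment> \<open>A full round from \<open>b k\<close> to \<open>b (Suc k)\<close> multiplies the
    distance to \<open>x\<close> by at most the square of \<open>q\<close>, so \<open>b k\<close>
    within \<epsilon>' puts the next two iterates within \<epsilon>.\<close>
  define \<epsilon>' where "\<epsilon>' = \<epsilon> / q\<^sup>2"
  have \<epsilon>': "\<epsilon>' > 0" using \<epsilon> q by (simp add: \<epsilon>'_def)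
  have "continuous_on {0..<\<eta>} \<phi>" using \<phi> by (simp add: desingularizing_def)
  moreover have "0 \<in> {0..<\<eta>}" "\<epsilon>' / (2 * K) > 0" using \<eta> \<epsilon>' K by simp_all
  ultimately have "\<exists>\<tau>>0. \<forall>s\<in>{0..<\<eta>}. dist s 0 < \<tau> \<longrightarrow> dist (\<phi> s) (\<phi> 0) < \<epsilon>' / (2 * K)"
    unfolding continuous_on_iff by blast
  then obtain \<tau> where \<tau>: "\<tau> > 0" "\<And>s. \<lbrakk>0 \<le> s; s < \<eta>; s < \<tau>\<rbrakk> \<Longrightarrow> \<phi> s < \<epsilon>' / (2 * K)"
    using \<phi>0 by (force simp: dist_real_def)
  \<comment> \<open>The first bound makes \<open>norm (b 0 - x) + 2 * norm (b 0 - b 1)\<close> at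
    most half of \<epsilon>'; the second makes \<open>r 1\<close> below \<tau>, so that
    \<open>K * \<phi> (r 1)\<close> takes less than the other half.\<close>
  define \<rho> where "\<rho> = min (\<epsilon>' / (2 * (3 + 2 * q\<^sup>2))) (sqrt (\<tau> / C) / (4 * q\<^sup>2))"
  have \<rho>: "\<rho> > 0" using \<epsilon>' \<tau> q C_pos by (simp add: \<rho>_def add_pos_nonneg)
  have \<rho>1: "(3 + 2 * q\<^sup>2) * \<rho> \<le> \<epsilon>' / 2"
  proof -
    have "3 + 2 * q\<^sup>2 > 0" by (simp add: add_pos_nonneg)
    moreover have "\<rho> \<le> \<epsilon>' / (2 * (3 + 2 * q\<^sup>2))" by (simp add: \<rho>_def)
    ultimately show ?thesis by (simp add: field_simps)
  qed
  have \<rho>2: "C * (2 * q\<^sup>2 * \<rho>)\<^sup>2 < \<tau>"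
  proof -
    have "\<rho> \<le> sqrt (\<tau> / C) / (4 * q\<^sup>2)" by (simp add: \<rho>_def)
    then have "2 * q\<^sup>2 * \<rho> \<le> sqrt (\<tau> / C) / 2" using q by (simp add: field_simps)
    then have "(2 * q\<^sup>2 * \<rho>)\<^sup>2 \<le> (sqrt (\<tau> / C) / 2)\<^sup>2"
      using \<rho> by (intro power_mono) auto
    then have "C * (2 * q\<^sup>2 * \<rho>)\<^sup>2 \<le> \<tau> / 4"
      using C_pos \<tau>(1) by (simp add: power_divide field_simps)
    then show ?thesis using \<tau>(1) by simp
  qed

  \<comment> \<open>Only \<open>b 0\<close> is assumed near \<open>x\<close>, not
    \<open>a 0\<close>, so \<phi> is evaluated at \<open>r 1\<close> and later values only.\<close>
  have main: "\<exists>b\<^sub>s \<in> A \<inter> B. a \<longlonglongrightarrow> b\<^sub>s \<and> b \<longlonglongrightarrow> b\<^sub>s"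
    if alt: "bregman_alternating f A B a b" and start: "norm (b 0 - x) < \<rho>" for a b
  proof -
    note block = rl_block_of_alternating[OF alt]
    have mem: "a k \<in> A" "b k \<in> B" for k using alt by (auto simp: bregman_alternating_def)
    define r d where "r = (\<lambda>k. D (b k) (a k))" and "d = (\<lambda>k. norm (b k - b (Suc k)))"
    have r_nonneg: "r k \<ge> 0" for k using mem D_nonneg by (simp add: r_def)
    have r_mid: "D (b k) (a (Suc k)) \<le> r k" for k
      using alt mem right_proj_D(2)[of "a (Suc k)" "b k" "a k"]
      by (auto simp: r_def bregman_alternating_def)
    have r_dec: "r (Suc k) \<le> r k" for k
      using alt mem left_proj_D(2)[of "b (Suc k)" "a (Suc k)" "b k"] r_mid[of k]
      by (force simp: r_def bregman_alternating_def)
    have near_a: "norm (a (Suc k) - x) \<le> q * norm (b k - x)" for k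
      using alt mem x right_proj_near by (simp add: q_def bregman_alternating_def)
    have near_b: "norm (b (Suc k) - x) \<le> q * norm (a (Suc k) - x)" for k
      using alt mem x left_proj_near by (simp add: q_def bregman_alternating_def)
    have near_q: "norm (a (Suc k) - x) \<le> q\<^sup>2 * norm (b k - x)"
      "norm (b (Suc k) - x) \<le> q\<^sup>2 * norm (b k - x)" for k
    proof -
      have "1 * norm (a (Suc k) - x) \<le> q * norm (a (Suc k) - x)"
        using q by (intro mult_right_mono) auto
      moreover have "q * norm (a (Suc k) - x) \<le> q * (q * norm (b k - x))"
        using q near_a[of k] by (intro mult_left_mono) auto
      ultimately show "norm (a (Suc k) - x) \<le> q\<^sup>2 * norm (b k - x)"
        "norm (b (Suc k) - x) \<le> q\<^sup>2 * norm (b k - x)"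
        using near_b[of k] by (simp_all add: power2_eq_square)
    qed
    have near: "norm (a (Suc k) - x) < \<epsilon>" "norm (b (Suc k) - x) < \<epsilon>"
      if "norm (b k - x) < \<epsilon>'" for k
    proof -
      have "q\<^sup>2 * norm (b k - x) < \<epsilon>" using that q by (simp add: \<epsilon>'_def field_simps)
      then show "norm (a (Suc k) - x) < \<epsilon>" "norm (b (Suc k) - x) < \<epsilon>"
        using near_q[of k] by simp_all
    qed
    have r_small: "r (Suc k) < \<eta>" if "norm (b k - x) < \<epsilon>'" for k
      using near[OF that] mem unfolding r_def by (intro small) auto
    \<comment> \<open>The three-point inequality starts from
      \<open>D (b (Suc k)) (a (Suc (Suc k)))\<close>; the right projection bounds this by
      \<open>r (Suc k)\<close>.\<close>
    have three_k: "l * c * (d (Suc k))\<^sup>2 \<le> r (Suc k) - r (Suc (Suc k))"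
      if "norm (b (Suc k) - x) < \<epsilon>'" for k
      using three_block[OF block near(2,1)[OF that]] r_mid[of "Suc k"] by (simp add: r_def d_def)
    have angle_k: "\<kappa> \<le> deriv \<phi> (r (Suc k)) * d k"
      if "norm (b k - x) < \<epsilon>'" "r (Suc k) > 0" for k
      using angle_block[OF block near(2,1)[OF that(1)]] that(2) by (simp add: r_def d_def)
    have step: "2 * d (Suc k) \<le> d k + K * \<phi> (r (Suc k)) - K * \<phi> (r (Suc (Suc k)))"
      if nb: "norm (b k - x) < \<epsilon>'" "norm (b (Suc k) - x) < \<epsilon>'" for k
    proof (cases "r (Suc k) = 0")
      \<comment> \<open>The angle condition is silent at gap 0, but then \<open>r\<close> stays 0
        and the three-point inequality alone stops the sequence \<open>b\<close>.\<close>
      case True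
      then have r0: "r (Suc (Suc k)) = 0"
        using r_dec[of "Suc k"] r_nonneg[of "Suc (Suc k)"] by simp
      with True three_k[OF nb(2)] have "l * c * (d (Suc k))\<^sup>2 \<le> 0" by simp
      then have "d (Suc k) = 0"
        using l c_pos by (simp add: mult_le_0_iff)
      then show ?thesis using True r0 by (simp add: d_def)
    next
      case False
      define t \<Delta> where "t = deriv \<phi> (r (Suc k))" and "\<Delta> = \<phi> (r (Suc k)) - \<phi> (r (Suc (Suc k)))"
      have pos: "r (Suc k) > 0" using False r_nonneg[of "Suc k"] by simp
      have t: "t > 0" using pos r_small[OF nb(1)] by (simp add: t_def \<phi>')
      have tangent: "t * (r (Suc k) - r (Suc (Suc k))) \<le> \<Delta>"
        unfolding t_def \<Delta>_def using pos r_small[OF nb(1)] r_nonneg r_dec[of "Suc k"]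
        by (intro desingularizing_tangent[OF \<phi>]) auto
      then have \<Delta>: "\<Delta> \<ge> 0"
        using t r_dec[of "Suc k"] by (smt (verit) mult_nonneg_nonneg)
      have d_nonneg: "d j \<ge> 0" for j by (simp add: d_def)
      have "\<kappa> * (l * c * (d (Suc k))\<^sup>2) \<le> t * d k * (l * c * (d (Suc k))\<^sup>2)"
        using angle_k[OF nb(1) pos] l c_pos by (intro mult_right_mono) (auto simp: t_def)
      also have "\<dots> \<le> t * d k * (r (Suc k) - r (Suc (Suc k)))"
        using three_k[OF nb(2)] t d_nonneg by (intro mult_left_mono) auto
      also have "\<dots> \<le> d k * \<Delta>"
        using mult_left_mono[OF tangent d_nonneg[of k]] by (simp add: mult_ac)
      finally have "(d (Suc k))\<^sup>2 \<le> d k * (K * \<Delta>)"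
        using \<kappa> l c_pos by (simp add: K_def field_simps)
      \<comment> \<open>Arithmetic-geometric mean inequality: four times the product of
        \<open>d k\<close> and \<open>K * \<Delta>\<close> is at most the square of their
        sum.\<close>
      moreover have "0 \<le> (d k - K * \<Delta>)\<^sup>2" by simp
      ultimately have "(2 * d (Suc k))\<^sup>2 \<le> (d k + K * \<Delta>)\<^sup>2"
        by (simp add: power2_eq_square algebra_simps)
      then have "2 * d (Suc k) \<le> d k + K * \<Delta>"
        by (rule power2_le_imp_le) (use K \<Delta> d_nonneg in auto)
      then show ?thesis by (simp add: \<Delta>_def algebra_simps)
    qed

    have b0: "norm (b 0 - x) < \<epsilon>'"
    proof -
      have "1 * \<rho> \<le> (3 + 2 * q\<^sup>2) * \<rho>" using \<rho> by (intro mult_right_mono) auto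
      then show ?thesis using \<rho>1 start \<epsilon>' by simp
    qed
    \<comment> \<open>Monotonicity of \<open>r\<close> gives this for all later indices before the
      iterates are known to stay near \<open>x\<close>, as the nonnegativity premise of the trapping
      lemma requires.\<close>
    have r1: "r k < \<eta>" if "k > 0" for k
    proof -
      have "r k \<le> r 1"
        using lift_Suc_antimono_le[of r, OF r_dec, of 1 k] that by simp
      then show ?thesis using r_small[OF b0] by simp
    qed
    have near1: "norm (a 1 - x) \<le> q\<^sup>2 * \<rho>" "norm (b 1 - x) \<le> q\<^sup>2 * \<rho>"
    proof -
      have "q\<^sup>2 * norm (b 0 - x) \<le> q\<^sup>2 * \<rho>" using start by (intro mult_left_mono) auto
      then show "norm (a 1 - x) \<le> q\<^sup>2 * \<rho>" "norm (b 1 - x) \<le> q\<^sup>2 * \<rho>"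
        using near_q[of 0] by simp_all
    qed
    have "K * \<phi> (r 1) < \<epsilon>' / 2"
    proof -
      have "norm (b 1 - a 1) \<le> 2 * q\<^sup>2 * \<rho>"
        using norm_triangle_ineq4[of "b 1 - x" "a 1 - x"] near1 by simp
      then have "C * (norm (b 1 - a 1))\<^sup>2 \<le> C * (2 * q\<^sup>2 * \<rho>)\<^sup>2"
        using C_pos by (intro mult_left_mono power_mono) auto
      then have "r 1 < \<tau>" using D_upper[of "b 1" "a 1"] mem \<rho>2 by (simp add: r_def)
      then have "\<phi> (r 1) < \<epsilon>' / (2 * K)" using \<tau>(2) r_nonneg r1[of 1] by simp
      then show ?thesis using K by (simp add: field_simps)
    qed
    moreover have "norm (b 0 - b 1) \<le> \<rho> + q\<^sup>2 * \<rho>"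
      using norm_triangle_ineq4[of "b 0 - x" "b 1 - x"] near1 start by simp
    ultimately have "norm (b 0 - x) + 2 * norm (b 0 - b 1) + K * \<phi> (r (Suc 0)) < \<epsilon>'"
      using start \<rho>1 by (simp add: algebra_simps)
    note trapped = trapped_sequence_converges[of b x \<epsilon>' "\<lambda>k. K * \<phi> (r (Suc k))",
        OF step[unfolded d_def] _ this]
    have p_nonneg: "K * \<phi> (r (Suc k)) \<ge> 0" for k
      using K \<phi>_nonneg r_nonneg r1 by simp
    have all_near: "norm (b k - x) < \<epsilon>'" for k
      using trapped(1) p_nonneg by blast
    obtain b\<^sub>s where b\<^sub>s: "b \<longlonglongrightarrow> b\<^sub>s"
      using trapped(2) p_nonneg unfolding convergent_def by blast

    \<comment> \<open>The tangent inequality with second point 0 bounds s \<phi>'(s) by \<phi>(s),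
      hence by \<open>\<phi> (r 1)\<close>; multiplying the angle bound by s =
      \<open>r (Suc k)\<close> then controls the gap by the step length, which tends to 0.\<close>
    have r_le_d: "r (Suc k) \<le> \<phi> (r 1) / \<kappa> * d k" for k
    proof (cases "r (Suc k) = 0")
      case True
      have "0 \<le> \<phi> (r 1) / \<kappa> * d k"
        using \<kappa> \<phi>_nonneg[of "r 1"] r_nonneg r1[of 1] by (simp add: d_def)
      then show ?thesis using True by simp
    next
      case False
      then have pos: "r (Suc k) > 0" using r_nonneg[of "Suc k"] by simp
      have "deriv \<phi> (r (Suc k)) * (r (Suc k) - 0) \<le> \<phi> (r (Suc k)) - \<phi> 0"
        using pos r1 \<eta> by (intro desingularizing_tangent[OF \<phi>]) auto
      also have "\<dots> \<le> \<phi> (r 1)"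
        using desingularizing_mono[OF \<phi> r_nonneg, of "Suc k" "r 1"]
          lift_Suc_antimono_le[of r, OF r_dec, of 1 "Suc k"] r1[of 1] \<phi>0 by simp
      finally have "deriv \<phi> (r (Suc k)) * r (Suc k) * d k \<le> \<phi> (r 1) * d k"
        by (intro mult_right_mono) (auto simp: d_def)
      moreover have "\<kappa> * r (Suc k) \<le> deriv \<phi> (r (Suc k)) * d k * r (Suc k)"
        using angle_k[OF all_near pos] pos by (intro mult_right_mono) auto
      ultimately have "\<kappa> * r (Suc k) \<le> \<phi> (r 1) * d k" by (simp add: mult_ac)
      then show ?thesis using \<kappa> by (simp add: field_simps)
    qed
    have "d \<longlonglongrightarrow> norm (b\<^sub>s - b\<^sub>s)"
      unfolding d_def by (rule tendsto_norm[OF tendsto_diff[OF b\<^sub>s LIMSEQ_Suc[OF b\<^sub>s]]])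
    then have "(\<lambda>k. \<phi> (r 1) / \<kappa> * d k / c) \<longlonglongrightarrow> 0"
      using \<kappa> c_pos by (auto intro!: tendsto_eq_intros)
    moreover have "(norm (b (Suc k) - a (Suc k)))\<^sup>2 \<le> \<phi> (r 1) / \<kappa> * d k / c" for k
    proof -
      have "(norm (b (Suc k) - a (Suc k)))\<^sup>2 * c \<le> r (Suc k)"
        using D_lower[of "b (Suc k)" "a (Suc k)"] mem by (simp add: r_def mult.commute)
      also note r_le_d
      finally show ?thesis
        unfolding pos_le_divide_eq[OF c_pos] .
    qed
    ultimately have "(\<lambda>k. (norm (b (Suc k) - a (Suc k)))\<^sup>2) \<longlonglongrightarrow> 0"
      by (rule_tac tendsto_sandwich[OF _ _ tendsto_const]) auto
    then have "(\<lambda>k. b (Suc k) - a (Suc k)) \<longlonglongrightarrow> 0"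
      by (simp add: tendsto_norm_zero_iff)
    then have "(\<lambda>k. b (Suc k) - (b (Suc k) - a (Suc k))) \<longlonglongrightarrow> b\<^sub>s - 0"
      by (rule tendsto_diff[OF LIMSEQ_Suc[OF b\<^sub>s]])
    then have a: "a \<longlonglongrightarrow> b\<^sub>s" by (simp add: filterlim_sequentially_Suc)
    have "b\<^sub>s \<in> A" using closed_sequentially[OF \<open>closed A\<close> _ a] mem by blast
    moreover have "b\<^sub>s \<in> B" using closed_sequentially[OF \<open>closed B\<close> _ b\<^sub>s] mem by blast
    ultimately show ?thesis using a b\<^sub>s by blast
  qed

  show ?thesis
  \<comment> \<open>The factor \<open>q\<close> pays for passing from \<open>a k\<close> to
    \<open>b k\<close> when it is \<open>a k\<close> that enters; the sequence is then restarted at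
    index \<open>k\<close>, which leaves limits unchanged.\<close>
  proof (intro exI[of _ "ball x (\<rho> / q)"] conjI allI impI)
    show "x \<in> ball x (\<rho> / q)" using \<rho> q by simp
    fix a b assume "bregman_alternating f A B a b \<and> (\<exists>k. a k \<in> ball x (\<rho> / q) \<or> b k \<in> ball x (\<rho> / q))"
    then obtain k where alt: "bregman_alternating f A B a b"
      and k: "norm (a k - x) < \<rho> / q \<or> norm (b k - x) < \<rho> / q"
      by (auto simp: dist_norm norm_minus_commute)
    have shift: "bregman_alternating f A B (\<lambda>n. a (n + k)) (\<lambda>n. b (n + k))"
      using alt by (simp add: bregman_alternating_def)
    have "norm (b k - x) < \<rho>"
      using k
    proof
      assume "norm (a k - x) < \<rho> / q"
      then have "q * norm (a k - x) < \<rho>" using q by (simp add: field_simps)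
      moreover have "norm (b k - x) \<le> q * norm (a k - x)"
        unfolding q_def using alt x by (intro left_proj_near) (auto simp: bregman_alternating_def)
      ultimately show ?thesis by simp
    next
      assume "norm (b k - x) < \<rho> / q"
      moreover have "\<rho> / q \<le> \<rho>" using q \<rho> by (simp add: field_simps)
      ultimately show ?thesis by simp
    qed
    then have "\<exists>b\<^sub>s\<in>A \<inter> B. (\<lambda>n. a (n + k)) \<longlonglongrightarrow> b\<^sub>s \<and> (\<lambda>n. b (n + k)) \<longlonglongrightarrow> b\<^sub>s"
      using main[OF shift] by simp
    then show "\<exists>b\<^sub>s\<in>A \<inter> B. a \<longlonglongrightarrow> b\<^sub>s \<and> b \<longlonglongrightarrow> b\<^sub>s"
      using LIMSEQ_offset by blast
  qed simp
qed

end

theorem theorem7p3: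
  fixes f :: "real^'n \<Rightarrow> ereal" and A B :: "(real^'n) set" and x :: "real^'n"
  assumes "legendre_type f"
    and "C2_on (int_dom f) (rpart f)"
    and "\<forall>y\<in>int_dom f. pos_def (hessian (rpart f) y)"
    and "A \<noteq> {}" "closed A" "bounded A" "A \<subseteq> int_dom f"
    and "B \<noteq> {}" "closed B" "bounded B" "B \<subseteq> int_dom f"
    and "x \<in> A \<inter> B"
    and "rl_angle_condition f A B x"
    and "rl_three_point f A B x"
  shows "\<exists>V. open V \<and> x \<in> V \<and>
           (\<forall>a b. bregman_alternating f A B a b \<and> (\<exists>k. a k \<in> V \<or> b k \<in> V) \<longrightarrow>
              (\<exists>b\<^sub>s \<in> A \<inter> B. a \<longlonglongrightarrow> b\<^sub>s \<and> b \<longlonglongrightarrow> b\<^sub>s))"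
proof -
  \<comment> \<open>Segments may leave \<open>A \<union> B\<close>, so the bounds are derived on its
    convex hull, which is compact and stays in the convex set \<open>int_dom f\<close>.\<close>
  define K where "K = convex hull (A \<union> B)"
  have G: "convex (int_dom f)" and conv: "ereal_convex f"
    using assms(1) by (auto simp: legendre_type_def strictly_convex_on_def)
  have "compact (A \<union> B)" using assms by (auto simp: compact_eq_bounded_closed)
  then have "compact K" unfolding K_def by (rule compact_convex_hull)
  moreover have "K \<subseteq> int_dom f" unfolding K_def using G assms by (intro hull_minimal) auto
  moreover have "convex K" by (simp add: K_def)
  ultimately have "\<exists>c>0. \<exists>C>0. \<forall>u\<in>K. \<forall>v\<in>K.
      ereal (c * (norm (u - v))\<^sup>2) \<le> bregman f u v \<and> bregman f u v \<le> ereal (C * (norm (u - v))\<^sup>2)"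
    using assms(3) by (intro bregman_quadratic_bounds conv assms(2)) auto
  then obtain c C where cC: "c > 0" "C > 0"
    "\<forall>u\<in>K. \<forall>v\<in>K. ereal (c * (norm (u - v))\<^sup>2) \<le> bregman f u v \<and>
      bregman f u v \<le> ereal (C * (norm (u - v))\<^sup>2)"
    by blast
  have "A \<union> B \<subseteq> K" unfolding K_def by (rule hull_subset)
  with cC interpret quadratic_bregman f A B c C
    by unfold_locales blast+
  show ?thesis
    using assms by (intro alternating_converges) auto
qed

end
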